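(* Let $n\ge 3$, $1<k<n/2$ and $p>p_{so}:=\frac{(n+2)k}{n-2k}$. Then every regular solution $u_\mu$ of (1.6) satisfies $u_\mu(r)\simeq r^{-\frac{2k}{p-k}}$ for large $r$, i.e. there is $C>1$ with $\frac1C\le u_\mu(r)r^{\frac{2k}{p-k}}\le C$ for all sufficiently large $r$. Moreover, every regular solution has the form $u_\mu(r)=\mu^{\frac{2k}{p-k}}u_1(\mu r)$, $r\ge 0$, for some $\mu>0$, where $u_1$ is the solution of (1.6) with $\rho=1$ (i.e. $u_1(0)=1$, $u_1'(0)=0$).
   Context: Here $C_{n-1}^{k-1}$ denotes the binomial coefficient. Problem (1.6) is: given $\rho>0$, find $u$ with $$-\tfrac{1}{k}C_{n-1}^{k-1}\big(r^{n-k}|u'|^{k-1}u'\big)'=r^{n-1}u^{p},\quad u(r)>0 \text{ for all } r>0,\qquad u'(0)=0,\ u(0)=\rho .$$ A solution $u$ of (1.6) is called regular if the function $x\mapsto u(|x|)$ belongs to $C^2(\mathbb{R}^n)$. *)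

theory Defs
  imports "HOL-Analysis.Analysis"
begin

definition C2_UNIV :: "('a::euclidean_space \<Rightarrow> real) \<Rightarrow> bool" where
  "C2_UNIV f \<longleftrightarrow>
     (\<exists>D :: 'a \<Rightarrow> ('a \<Rightarrow>\<^sub>L real). \<exists>D2 :: 'a \<Rightarrow> ('a \<Rightarrow>\<^sub>L ('a \<Rightarrow>\<^sub>L real)).
        (\<forall>x. (f has_derivative blinfun_apply (D x)) (at x)) \<and>
        (\<forall>x. (D has_derivative blinfun_apply (D2 x)) (at x)) \<and>
        continuous_on UNIV D2)"

definition sol16 :: "nat \<Rightarrow> nat \<Rightarrow> real \<Rightarrow> real \<Rightarrow> (real \<Rightarrow> real) \<Rightarrow> bool" where
  "sol16 n k p \<rho> u \<longleftrightarrow>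
     u 0 = \<rho> \<and> (\<forall>r>0. u r > 0) \<and>
     (u has_real_derivative 0) (at 0 within {0..}) \<and>
     (\<forall>r>0. u differentiable (at r)) \<and>
     (\<forall>r>0. \<exists>W'. ((\<lambda>s. s ^ (n - k) * \<bar>deriv u s\<bar> ^ (k - 1) * deriv u s)
                        has_real_derivative W') (at r) \<and>
               - (1 / real k) * real ((n - 1) choose (k - 1)) * W' = r ^ (n - 1) * u r powr p)"

definition regular_sol :: "('n::finite) itself \<Rightarrow> nat \<Rightarrow> real \<Rightarrow> real \<Rightarrow> (real \<Rightarrow> real) \<Rightarrow> bool" where
  "regular_sol _ k p \<rho> u \<longleftrightarrow>
     sol16 CARD('n) k p \<rho> u \<and> C2_UNIV (\<lambda>x :: real ^ 'n. u (norm x))"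

end

theory Submission
  imports Defs
begin

text \<open>With the flux $W = r^{n-k}(-u')^k$, the quantities $X = r W'/W$ and $Z = -r u'/u$ satisfy a
  Lotka--Volterra system in $\log r$:
  $r X' = X (n - X - p Z)$ and $r Z' = -(Z/k)\,q$ with $q = n - 2k - kZ - X$.
  Moreover $X Z^k$ is a constant multiple of $(u\,r^{2k/(p-k)})^{p-k}$, so the decay rate amounts to
  $X Z^k$ staying away from $0$ and $\infty$. At the critical exponent the system has the
  first integral $H = X^a Z^b (n - 2k - kZ - mX)$. For larger $p$ one finds
  $r H' = -\eta a X^a Z^b q$, which has no sign, but subtracting a suitable function $G(Z)$ turns
  the right-hand side into $\eta a Z^b q\,((X + q)_+^a - X^a) \ge 0$. As $H - G(Z)$ tends to $0$ at
  the origin, it is eventually bounded below by a positive constant, hence so is $H$ because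
  $G \ge 0$; this confines $(X, Z)$ to a compact part of the open quadrant.

  For the second claim, the equation is invariant under the scaling, and the singular initial value
  problem at $r = 0$ has at most one solution.\<close>

section \<open>One-sided comparison from the origin\<close>

text \<open>Monotonicity on (0, r] passes to the limit at 0. This replaces integration from the
  origin, where the equation is singular: nothing is assumed about \<open>h\<close> at 0 except its
  right limit.\<close>

lemma right_limit_le:
  fixes h h' :: "real \<Rightarrow> real"
  assumes deriv: "\<And>s. 0 < s \<Longrightarrow> s \<le> r \<Longrightarrow> (h has_real_derivative h' s) (at s)"
    and nonneg: "\<And>s. 0 < s \<Longrightarrow> s \<le> r \<Longrightarrow> 0 \<le> h' s"
    and lim: "(h \<longlongrightarrow> l) (at_right 0)" and "0 < r"
  shows "l \<le> h r"
proof (rule tendsto_upperbound[OF lim])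
  have "h s \<le> h r" if "0 < s" "s < r" for s
  proof (rule DERIV_nonneg_imp_nondecreasing[where f = h])
    show "\<exists>y. (h has_real_derivative y) (at x) \<and> 0 \<le> y" if "s \<le> x" "x \<le> r" for x
      using deriv[of x] nonneg[of x] that \<open>0 < s\<close> by auto
  qed (use that in auto)
  then show "\<forall>\<^sub>F s in at_right 0. h s \<le> h r"
    using \<open>0 < r\<close> by (auto simp: eventually_at_right_field)
qed simp

text \<open>Both \<open>g - f\<close> and \<open>g + f\<close> are nondecreasing. The majorant
  \<open>g\<close> may start from any limit \<open>l\<close> that is nonnegative, so exponentials
  qualify.\<close>

lemma abs_le_of_deriv_bound:
  fixes f f' g g' :: "real \<Rightarrow> real"
  assumes f: "\<And>s. 0 < s \<Longrightarrow> s \<le> r \<Longrightarrow> (f has_real_derivative f' s) (at s)"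
    and g: "\<And>s. 0 < s \<Longrightarrow> s \<le> r \<Longrightarrow> (g has_real_derivative g' s) (at s)"
    and le: "\<And>s. 0 < s \<Longrightarrow> s \<le> r \<Longrightarrow> \<bar>f' s\<bar> \<le> g' s"
    and f0: "(f \<longlongrightarrow> 0) (at_right 0)" and g0: "(g \<longlongrightarrow> l) (at_right 0)"
    and "0 \<le> l" "0 < r"
  shows "\<bar>f r\<bar> \<le> g r"
proof -
  have "0 \<le> g' s - f' s" "0 \<le> g' s + f' s" if "0 < s" "s \<le> r" for s
    using le[OF that] by linarith+
  then have "l - 0 \<le> g r - f r" "l + 0 \<le> g r + f r"
    using right_limit_le[OF DERIV_diff[OF g f] _ tendsto_diff[OF g0 f0] \<open>0 < r\<close>]
      right_limit_le[OF DERIV_add[OF g f] _ tendsto_add[OF g0 f0] \<open>0 < r\<close>] by auto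
  then show ?thesis
    using \<open>0 \<le> l\<close> by linarith
qed

section \<open>The radial equation in flux form\<close>

text \<open>Here \<open>v\<close> is -u' and \<open>c\<close> is the binomial coefficient divided by
  k; \<open>flux_deriv_aux\<close> is the differential equation once u' is known to be negative. The
  regularity of the solution at the origin enters through \<open>u_cont\<close> and
  \<open>v_bounded\<close>.\<close>

locale radial_solution =
  fixes n k :: nat and p c :: real and u v :: "real \<Rightarrow> real"
  assumes k_pos: "0 < k" and k_less: "2 * k < n"
    and supercritical: "p > real ((n + 2) * k) / (real n - 2 * real k)"
    and c_pos: "0 < c"
    and u_pos: "0 \<le> r \<Longrightarrow> 0 < u r"
    and u_cont: "continuous_on {0..} u"
    and u_deriv: "0 < r \<Longrightarrow> (u has_real_derivative - v r) (at r)"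
    and v_pos: "0 < r \<Longrightarrow> 0 < v r"
    and v_bounded: "\<exists>B. \<forall>\<^sub>F r in at_right 0. v r \<le> B"
    and flux_deriv_aux: "0 < r \<Longrightarrow>
          ((\<lambda>s. s ^ (n - k) * v s ^ k) has_real_derivative r ^ (n - 1) * u r powr p / c) (at r)"
begin

definition flux :: "real \<Rightarrow> real" where
  "flux r = r ^ (n - k) * v r ^ k"

lemma flux_deriv: "0 < r \<Longrightarrow> (flux has_real_derivative r ^ (n - 1) * u r powr p / c) (at r)"
  using flux_deriv_aux[of r] by (simp add: flux_def[abs_def])

lemma flux_pos: "0 < r \<Longrightarrow> 0 < flux r"
  by (simp add: flux_def v_pos)

lemma lam_pos: "real n - 2 * real k > 0"
  using k_less by linarith

lemma supercritical': "(real n + 2) * real k < p * (real n - 2 * real k)"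
  using supercritical lam_pos by (simp add: pos_divide_less_eq algebra_simps)

lemma p_gt_k: "real k < p"
proof -
  have "real k * (real n - 2 * real k) \<le> (real n + 2) * real k"
    by (simp add: algebra_simps)
  also note supercritical'
  finally show ?thesis
    using lam_pos by (simp add: mult_less_cancel_right)
qed

lemma p_gt_1: "1 < p"
  using p_gt_k k_pos by (metis Suc_leI less_le_trans not_le of_nat_1 of_nat_le_iff One_nat_def)

lemma u_antimono:
  assumes "0 \<le> s" "s \<le> r" shows "u r \<le> u s"
proof (rule DERIV_nonpos_imp_decreasing_open[where f = u])
  show "continuous_on {s..r} u"
    using u_cont assms by (auto intro: continuous_on_subset)
  show "\<exists>y. (u has_real_derivative y) (at x) \<and> y \<le> 0" if "s < x" "x < r" for x
    using u_deriv[of x] v_pos[of x] assms that by force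
qed (use assms in auto)

lemma id_times_v_tendsto_0: "((\<lambda>r. r * v r) \<longlongrightarrow> 0) (at_right 0)"
proof -
  obtain B where B: "\<forall>\<^sub>F r in at_right 0. v r \<le> B"
    using v_bounded by blast
  have pos: "\<forall>\<^sub>F r::real in at_right 0. 0 < r"
    by (simp add: eventually_at_right_less)
  show ?thesis
  proof (rule tendsto_sandwich)
    show "((\<lambda>r::real. 0) \<longlongrightarrow> 0) (at_right (0::real))" by simp
    show "((\<lambda>r. r * B) \<longlongrightarrow> 0) (at_right 0)" by (auto intro!: tendsto_eq_intros)
    show "\<forall>\<^sub>F r in at_right 0. 0 \<le> r * v r"
      using pos by eventually_elim (simp add: v_pos less_imp_le)
    show "\<forall>\<^sub>F r in at_right 0. r * v r \<le> r * B"
      using pos B by eventually_elim (simp add: mult_left_mono)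
  qed
qed

lemma flux_tendsto_0: "(flux \<longlongrightarrow> 0) (at_right 0)"
proof -
  have "n - k = (n - 2 * k) + k" using k_less by simp
  then have "flux = (\<lambda>r. r ^ (n - 2 * k) * (r * v r) ^ k)"
    by (simp only: flux_def[abs_def] power_add power_mult_distrib mult.assoc)
  moreover have "((\<lambda>r. r ^ (n - 2 * k) * (r * v r) ^ k) \<longlongrightarrow> 0 ^ (n - 2 * k) * 0 ^ k) (at_right 0)"
    by (intro tendsto_intros id_times_v_tendsto_0)
  ultimately show ?thesis
    using k_pos by (simp only: zero_power mult_zero_right)
qed

lemma u_tendsto: "(u \<longlongrightarrow> u 0) (at_right 0)"
proof (rule tendsto_within_subset)
  show "(u \<longlongrightarrow> u 0) (at 0 within {0..})"
    using u_cont by (simp add: continuous_on_def)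
qed auto

text \<open>As u decreases, u is at least \<open>w\<close> on all of (0, r], so the flux grows at
  least as fast as the antiderivative of s^(n-1) w^p / c. Taking \<open>w = u r\<close> gives X <=
  n; a \<open>w\<close> that serves a whole interval gives a linear lower bound for
  \<open>v\<close>.\<close>

lemma flux_lower_bound:
  assumes "0 < r" "0 \<le> w" "w \<le> u r"
  shows "w powr p * r ^ n / (c * n) \<le> flux r"
proof -
  have n: "0 < n" using k_less by simp
  have "0 - w powr p * 0 ^ n / (c * n) \<le> flux r - w powr p * r ^ n / (c * n)"
  proof (rule right_limit_le[where h = "\<lambda>s. flux s - w powr p * s ^ n / (c * n)"
        and h' = "\<lambda>s. s ^ (n - 1) * u s powr p / c - w powr p * (n * s ^ (n - 1)) / (c * n)"])
    fix s :: real assume s: "0 < s" "s \<le> r"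
    show "((\<lambda>s. flux s - w powr p * s ^ n / (c * n)) has_real_derivative
            s ^ (n - 1) * u s powr p / c - w powr p * (n * s ^ (n - 1)) / (c * n)) (at s)"
      using s n c_pos by (auto intro!: derivative_eq_intros flux_deriv)
    have "w powr p \<le> u s powr p"
      using s u_antimono[of s r] assms p_gt_1 by (intro powr_mono2) auto
    then show "0 \<le> s ^ (n - 1) * u s powr p / c - w powr p * (n * s ^ (n - 1)) / (c * n)"
      using n c_pos s by (simp add: field_simps mult_left_mono)
  qed (use assms n c_pos in \<open>auto intro!: tendsto_eq_intros flux_tendsto_0\<close>)
  then show ?thesis using n by (simp add: zero_power)
qed

section \<open>The Lotka-Volterra variables\<close>

definition X :: "real \<Rightarrow> real" where
  "X r = r ^ n * u r powr p / (c * flux r)"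

definition Z :: "real \<Rightarrow> real" where
  "Z r = r * v r / u r"

lemma X_pos: "0 < r \<Longrightarrow> 0 < X r"
  using u_pos[of r] by (simp add: X_def c_pos flux_pos)

lemma Z_pos: "0 < r \<Longrightarrow> 0 < Z r"
  by (simp add: Z_def u_pos v_pos)

lemma X_le: assumes "0 < r" shows "X r \<le> n"
proof -
  have "u r powr p * r ^ n / (c * n) \<le> flux r"
    using assms u_pos[of r] by (intro flux_lower_bound) auto
  then show ?thesis
    using assms c_pos flux_pos[OF assms] k_less by (simp add: X_def field_simps)
qed

lemma Z_tendsto_0: "(Z \<longlongrightarrow> 0) (at_right 0)"
proof -
  have "((\<lambda>r. r * v r / u r) \<longlongrightarrow> 0 / u 0) (at_right 0)"
    using u_pos[of 0] by (intro tendsto_intros id_times_v_tendsto_0 u_tendsto) auto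
  then show ?thesis by (simp add: Z_def[abs_def])
qed

text \<open>The factor v^k of Z^k cancels the one in the flux. What remains is the (p-k)-th power of
  u r^(2k/(p-k)), the quantity to be bounded.\<close>

lemma X_Z_power: assumes "0 < r" shows "c * (X r * Z r ^ k) = r ^ (2 * k) * u r powr (p - k)"
proof -
  have "n + k = (n - k) + 2 * k" using k_less by simp
  then have "r ^ n * r ^ k = r ^ (n - k) * r ^ (2 * k)"
    by (metis power_add)
  then show ?thesis
    using assms u_pos[of r] v_pos[OF assms] c_pos
    by (simp add: X_def Z_def flux_def powr_diff powr_realpow field_simps)
qed

text \<open>Logarithmic differentiation: r X'/X = n + p r u'/u - r W'/W, where r u'/u = -Z and r
  W'/W = X.\<close>

lemma X_deriv:
  assumes "0 < r" shows "(X has_real_derivative X r * (n - X r - p * Z r) / r) (at r)"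
proof -
  have n: "r ^ n = r * r ^ (n - 1)" using k_less by (subst power_Suc[symmetric]) simp
  have pw: "u r powr (p - 1) = u r powr p / u r" using u_pos[of r] assms by (simp add: powr_diff)
  show ?thesis
    unfolding X_def[abs_def] Z_def using assms u_pos[of r] c_pos flux_pos[OF assms]
    by (auto intro!: derivative_eq_intros flux_deriv u_deriv simp: pw n)
       (simp add: field_simps power2_eq_square)
qed

lemma v_eq: assumes "0 < r" shows "v r = (flux r / r ^ (n - k)) powr (1 / k)"
  using assms v_pos[OF assms] k_pos by (simp add: flux_def powr_realpow[symmetric] powr_powr)

text \<open>Differentiability of \<open>v\<close> is not assumed but recovered from that of the
  flux: \<open>v\<close> is the k-th root of W / r^(n-k), which is positive.\<close>

lemma v_deriv:
  assumes "0 < r" shows "(v has_real_derivative v r / k * (X r - (n - k)) / r) (at r)"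
proof (rule has_field_derivative_transform_within_open[of _ _ _ "{0<..}"])
  have n: "r ^ n = r * r ^ (n - 1)" using k_less by (subst power_Suc[symmetric]) simp
  have nk: "r ^ (n - k) = r * r ^ (n - k - 1)"
    using k_less power_minus_mult[of "n - k" r] by (simp add: mult.commute)
  let ?g = "\<lambda>s. flux s / s ^ (n - k)"
  have g: "(?g has_real_derivative ?g r * (X r - (n - k)) / r) (at r)"
  proof (rule DERIV_cong)
    show "(?g has_real_derivative (r ^ (n - 1) * u r powr p / c * r ^ (n - k)
        - flux r * (real (n - k) * r ^ (n - k - 1))) / (r ^ (n - k) * r ^ (n - k))) (at r)"
      using assms DERIV_pow[of "n - k" r UNIV] by (intro DERIV_divide flux_deriv) auto
    have "(A * B / c * (r * C) - F * (m * C)) / (r * C * (r * C))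
        = F / (r * C) * (r * A * B / (c * F) - m) / r" if "C \<noteq> 0" "F \<noteq> 0" for A B C F m :: real
      using that assms c_pos by (simp add: field_simps)
    from this[of "r ^ (n - k - 1)" "flux r" "r ^ (n - 1)" "u r powr p" "real (n - k)"]
    show "(r ^ (n - 1) * u r powr p / c * r ^ (n - k)
        - flux r * (real (n - k) * r ^ (n - k - 1))) / (r ^ (n - k) * r ^ (n - k))
        = ?g r * (X r - (n - k)) / r"
      using assms flux_pos[OF assms] unfolding X_def n nk by simp
  qed
  have pos: "0 < ?g r" using assms flux_pos by simp
  \<comment> \<open>The chain rule leaves the exponent 1/k - 1; the factor \<open>?g r\<close> in
    the derivative of \<open>?g\<close> restores 1/k, hence \<open>v r\<close>.\<close>
  have "?g r powr (1 / k - 1) * ?g r = v r"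
    using powr_add[of "?g r" "1 / k - 1" 1] less_imp_le[OF pos] pos
    by (simp only: powr_one) (simp add: v_eq[OF assms])
  moreover have "(1 / k) * E * (F * y / r) = w / k * y / r" if "E * F = w" for E F y w :: real
    unfolding that[symmetric] by simp
  ultimately have "(1 / k) * ?g r powr (1 / k - 1) * (?g r * (X r - (n - k)) / r)
      = v r / k * (X r - (n - k)) / r"
    by blast
  then show "((\<lambda>s. ?g s powr (1 / k)) has_real_derivative v r / k * (X r - (n - k)) / r) (at r)"
    using DERIV_fun_powr[OF g pos, of "1 / k"] by simp
qed (use assms v_eq in auto)

text \<open>Here r Z'/Z = 1 + r v'/v - r u'/u = 1 + (X - (n-k))/k + Z.\<close>

lemma Z_deriv:
  assumes "0 < r"
  shows "(Z has_real_derivative - (Z r / k * (real n - 2 * real k - k * Z r - X r)) / r) (at r)"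
proof -
  have "real (n - k) = real n - real k" using k_less by simp
  then show ?thesis
    unfolding Z_def[abs_def] using assms u_pos[of r] k_pos
    by (auto intro!: derivative_eq_intros u_deriv v_deriv)
       (simp add: field_simps power2_eq_square)
qed

section \<open>The Lyapunov function\<close>

text \<open>The exponents \<open>a\<close>, \<open>b\<close> are those for which the system multiplied by $X^{a-1} Z^{b-1}$ has
  divergence proportional to that factor.\<close>

definition lam :: real where "lam = real n - 2 * real k"
definition a :: real where "a = (real k + 1) / (p - k)"
definition b :: real where "b = real k * (p + 1) / (p - k)"
text \<open>This equals a/(a+1), the value for which the partial derivative in X of X^a Z^b (lam -
  kZ - mX) is a X^(a-1) Z^b times (lam - kZ - X).\<close>

definition m :: real where "m = (real k + 1) / (p + 1)"
text \<open>Measures the distance from the critical exponent: it vanishes at p = (n+2)k/(n-2k) and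
  is positive above it.\<close>

definition eta :: real where "eta = (lam * (p + 1) - real n * (real k + 1)) / (real k + 1)"

definition Q :: "real \<Rightarrow> real" where
  "Q r = lam - k * Z r - X r"

lemma params_pos: "0 < lam" "0 < a" "0 < b" "1 < b" "0 < m" "0 < eta"
proof -
  show "0 < lam" using lam_pos by (simp add: lam_def)
  show "0 < a" "0 < b" "0 < m" using p_gt_k p_gt_1 k_pos by (auto simp: a_def b_def m_def)
  have "p * 1 \<le> p * k" using k_pos p_gt_1 by (intro mult_left_mono) auto
  then have "p - k < real k * (p + 1)" using k_pos by (simp add: algebra_simps)
  then show "1 < b" using p_gt_k by (simp add: b_def pos_less_divide_eq)
  show "0 < eta"
    using supercritical' by (simp add: eta_def lam_def algebra_simps)
qed

text \<open>Hence X^a Z^b = (X Z^k)^a Z^k, which later turns a bound on H into one on X Z^k.\<close>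

lemma b_eq: "b = k + k * a"
  using p_gt_k by (simp add: a_def b_def field_simps)

text \<open>The derivative of the correction G. Since lam - kZ = X + Q is the value of X on the line
  Q = 0 with the same Z, subtracting G(Z) from H contributes eta a Z^b Q (X+Q)_+^a to the r-scaled
  derivative. The truncation keeps the base of the power nonnegative.\<close>

definition g :: "real \<Rightarrow> real" where
  "g z = eta * real k * a * z powr (b - 1) * max 0 (lam - real k * z) powr a"

text \<open>G is the integral of \<open>g\<close> from 0. The exponents b - 1 and a are positive, so
  \<open>g\<close> is continuous up to 0 and across the truncation point.\<close>

lemma g_antiderivative:
  obtains G where "\<And>z. 0 < z \<Longrightarrow> (G has_real_derivative g z) (at z)"
    and "(G \<longlongrightarrow> 0) (at_right 0)" and "\<And>z. 0 < z \<Longrightarrow> 0 \<le> G z"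
proof -
  have cont: "continuous_on {0..y} g" for y
  proof -
    have "continuous_on {0..y} (\<lambda>z. z powr (b - 1))"
      by (rule continuous_on_powr') (use params_pos in \<open>auto intro: continuous_intros\<close>)
    moreover have "continuous_on {0..y} (\<lambda>z. max 0 (lam - real k * z) powr a)"
      by (rule continuous_on_powr')
         (use params_pos in \<open>auto intro!: continuous_on_max continuous_on_diff continuous_on_mult
            continuous_on_const continuous_on_id\<close>)
    ultimately show ?thesis
      unfolding g_def[abs_def] by (intro continuous_on_mult continuous_on_const)
  qed
  let ?G = "\<lambda>z. integral {0..z} g"
  have D: "(?G has_real_derivative g z) (at z within {0..y})" if "0 \<le> z" "z \<le> y" for z y
    using integral_has_real_derivative[OF cont, of z y] that by simp
  show ?thesis
  proof
    show "(?G has_real_derivative g z) (at z)" if "0 < z" for z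
      using D[of z "z + 1"] that at_within_Icc_at[of 0 z "z + 1"] by simp
    have "continuous (at 0 within {0..1}) ?G"
      by (rule DERIV_continuous[OF D[of 0 1]]) auto
    then have "(?G \<longlongrightarrow> 0) (at 0 within {0..1})"
      by (simp add: continuous_within)
    then show "(?G \<longlongrightarrow> 0) (at_right 0)"
      by (simp add: at_within_Icc_at_right)
    show "0 \<le> ?G z" if "0 < z" for z
      using cont[of z] params_pos
      by (intro integral_nonneg integrable_continuous_interval) (auto simp: g_def)
  qed
qed

text \<open>The left-hand side is r H' / (X^a Z^b): the bracket a f - b q/k comes from the
  logarithmic derivative of X^a Z^b, and z q - m x f from differentiating lam - kz - mx.\<close>

lemma lyapunov_identity:
  fixes x z :: real
  assumes "f = n - x - p * z" and "q = lam - k * z - x"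
  shows "(a * f - b * q / k) * (lam - k * z - m * x) + z * q - m * x * f = - (eta * a * q)"
proof -
  have pk: "p - k \<noteq> 0" "p + 1 \<noteq> 0" "real k + 1 \<noteq> 0" using p_gt_k p_gt_1 by auto
  \<comment> \<open>The identity multiplied by (p-k)(p+1) is polynomial; the later equations put
    these denominators back.\<close>
  have "((real k + 1) * f - (p + 1) * q) * ((p + 1) * (lam - k * z) - (real k + 1) * x)
      + (p - k) * ((p + 1) * z * q - (real k + 1) * x * f)
      = - ((lam * (p + 1) - real n * (real k + 1)) * (p + 1) * q)"
    unfolding assms lam_def by algebra
  moreover have "a * f - b * q / k = ((real k + 1) * f - (p + 1) * q) / (p - k)"
    using k_pos by (simp add: a_def b_def diff_divide_distrib)
  moreover have "lam - k * z - m * x = ((p + 1) * (lam - k * z) - (real k + 1) * x) / (p + 1)"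
    using pk by (simp add: m_def field_simps)
  moreover have "z * q - m * x * f = (p - k) * ((p + 1) * z * q - (real k + 1) * x * f) / ((p - k) * (p + 1))"
    using pk by (simp add: m_def diff_divide_distrib)
  moreover have "- (eta * a * q) = - ((lam * (p + 1) - real n * (real k + 1)) * (p + 1) * q) / ((p - k) * (p + 1))"
    using pk by (simp add: eta_def a_def)
  ultimately show ?thesis
    by (simp only: times_divide_times_eq add_divide_distrib[symmetric] add_diff_eq[symmetric])
qed

definition H :: "real \<Rightarrow> real" where
  "H r = X r powr a * Z r powr b * (lam - k * Z r - m * X r)"

lemma lyapunov_deriv:
  assumes "0 < r" and G: "\<And>z. 0 < z \<Longrightarrow> (G has_real_derivative g z) (at z)"
  shows "((\<lambda>r. H r - G (Z r)) has_real_derivative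
           eta * a * Z r powr b * (Q r * (max 0 (X r + Q r) powr a - X r powr a)) / r) (at r)"
proof (rule DERIV_cong)
  define x z q where "x = X r" and "z = Z r" and "q = Q r"
  define f where "f = n - x - p * z"
  define P where "P = x powr a * z powr b"
  have pos: "0 < x" "0 < z" using assms X_pos Z_pos by (auto simp: x_def z_def)
  have q: "q = lam - k * z - x" by (simp add: q_def Q_def x_def z_def)
  have dX: "(X has_real_derivative x * f / r) (at r)"
    using X_deriv[OF assms(1)] by (simp add: x_def f_def z_def)
  have dZ: "(Z has_real_derivative - (z / k * q) / r) (at r)"
    using Z_deriv[OF assms(1)] by (simp add: z_def Q_def q_def lam_def)
  have dXa: "((\<lambda>r. X r powr a) has_real_derivative x powr a * (a * f) / r) (at r)"
    by (rule DERIV_cong[OF DERIV_fun_powr[OF dX]])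
       (use pos in \<open>simp_all add: x_def[symmetric] powr_diff\<close>)
  have dZb: "((\<lambda>r. Z r powr b) has_real_derivative z powr b * (- (b * q / k)) / r) (at r)"
    by (rule DERIV_cong[OF DERIV_fun_powr[OF dZ]])
       (use pos in \<open>simp_all add: z_def[symmetric] powr_diff\<close>)
  have dG: "((\<lambda>r. G (Z r)) has_real_derivative g z * (- (z / k * q) / r)) (at r)"
    using DERIV_chain2[OF G dZ] pos by (simp add: z_def)
  \<comment> \<open>The value here is the raw outcome of the product and chain rules; the remaining
    steps bring it to the stated form.\<close>
  show "((\<lambda>r. H r - G (Z r)) has_real_derivative
      ((x powr a * (a * f) / r) * z powr b + (z powr b * (- (b * q / k)) / r) * x powr a)
        * (lam - k * z - m * x)
      + (0 - k * (- (z / k * q) / r) - m * (x * f / r)) * P - g z * (- (z / k * q) / r)) (at r)"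
    using DERIV_diff[OF DERIV_mult[OF DERIV_mult[OF dXa dZb]
        DERIV_diff[OF DERIV_diff[OF DERIV_const DERIV_cmult[OF dZ]] DERIV_cmult[OF dX]]] dG]
    unfolding H_def P_def x_def z_def .
  have zb: "z powr (b - 1) * z = z powr b" using pos by (simp add: powr_diff)
  have gz: "g z * (- (z / k * q) / r) = - (eta * a * z powr b * q * max 0 (x + q) powr a / r)"
    using k_pos by (simp add: g_def zb[symmetric] q)
  have "((x powr a * (a * f) / r) * z powr b + (z powr b * (- (b * q / k)) / r) * x powr a)
        * (lam - k * z - m * x)
      + (0 - k * (- (z / k * q) / r) - m * (x * f / r)) * P
      = P * ((a * f - b * q / k) * (lam - k * z - m * x) + z * q - m * x * f) / r"
    using k_pos assms(1) by (simp add: P_def field_simps)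
  also have "\<dots> = P * (- (eta * a * q)) / r"
    by (simp only: lyapunov_identity[OF f_def q])
  finally show "((x powr a * (a * f) / r) * z powr b + (z powr b * (- (b * q / k)) / r) * x powr a)
        * (lam - k * z - m * x)
      + (0 - k * (- (z / k * q) / r) - m * (x * f / r)) * P - g z * (- (z / k * q) / r)
      = eta * a * Z r powr b * (Q r * (max 0 (X r + Q r) powr a - X r powr a)) / r"
    unfolding gz using assms(1)
    by (simp add: P_def x_def[symmetric] z_def[symmetric] q_def[symmetric] field_simps)
qed

text \<open>As a > 0, the map taking t to max(0,t)^a is nondecreasing, and strictly so at X > 0,
  hence the difference has the sign of Q.\<close>

lemma Q_times_nonneg:
  assumes "0 < r"
  shows "0 \<le> Q r * (max 0 (X r + Q r) powr a - X r powr a)"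
    and "Q r \<noteq> 0 \<Longrightarrow> 0 < Q r * (max 0 (X r + Q r) powr a - X r powr a)"
proof -
  show *: "0 < Q r * (max 0 (X r + Q r) powr a - X r powr a)" if "Q r \<noteq> 0"
  proof (cases "Q r > 0")
    case True
    then have "X r powr a < max 0 (X r + Q r) powr a"
      using X_pos[OF assms] params_pos by (intro powr_less_mono2) auto
    then show ?thesis using True by simp
  next
    case False
    then have "max 0 (X r + Q r) powr a < X r powr a"
      using X_pos[OF assms] params_pos that by (intro powr_less_mono2) auto
    then show ?thesis using False that by (simp add: mult_neg_neg)
  qed
  then show "0 \<le> Q r * (max 0 (X r + Q r) powr a - X r powr a)"
    by (cases "Q r = 0") (auto intro: less_imp_le)
qed

text \<open>X stays at most n while Z tends to 0, and b > 0, so the factor Z^b forces the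
  limit.\<close>

lemma H_tendsto_0: "(H \<longlongrightarrow> 0) (at_right 0)"
proof (rule Lim_null_comparison)
  show "\<forall>\<^sub>F r in at_right 0. norm (H r) \<le> n powr a * Z r powr b * (lam + k * Z r + m * n)"
  proof (rule eventually_at_right_less[THEN eventually_mono])
    fix r :: real assume r: "0 < r"
    have "\<bar>lam - k * Z r - m * X r\<bar> \<le> lam + k * Z r + m * X r"
      using params_pos X_pos[OF r] Z_pos[OF r] by (simp add: abs_if)
    also have "\<dots> \<le> lam + k * Z r + m * n"
      using params_pos X_le[OF r] by simp
    finally show "norm (H r) \<le> n powr a * Z r powr b * (lam + k * Z r + m * n)"
      using params_pos X_pos[OF r] X_le[OF r] Z_pos[OF r]
      by (auto simp: H_def abs_mult intro!: mult_mono powr_mono2)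
  qed
  have "((\<lambda>r. n powr a * Z r powr b * (lam + k * Z r + m * n)) \<longlongrightarrow>
      n powr a * 0 powr b * (lam + k * 0 + m * n)) (at_right 0)"
    using params_pos
    by (intro tendsto_intros tendsto_powr' Z_tendsto_0)
       (auto intro!: eventually_mono[OF eventually_at_right_less] less_imp_le Z_pos
        tendsto_mult_right_zero Z_tendsto_0)
  then show "((\<lambda>r. n powr a * Z r powr b * (lam + k * Z r + m * n)) \<longlongrightarrow> 0) (at_right 0)"
    using params_pos by simp
qed

text \<open>If Q vanished everywhere, Z would be constant on the half-line, although it is positive
  and tends to 0 at the origin.\<close>

lemma Q_not_identically_0: "\<exists>r>0. Q r \<noteq> 0"
proof (rule ccontr)
  assume *: "\<not> (\<exists>r>0. Q r \<noteq> 0)"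
  have "- 0 \<le> - Z 1"
  proof (rule right_limit_le[where h = "\<lambda>r. - Z r" and h' = "\<lambda>_. 0"])
    fix s :: real assume "0 < s"
    with * show "((\<lambda>r. - Z r) has_real_derivative 0) (at s)"
      using DERIV_minus[OF Z_deriv, of s] by (auto simp: Q_def lam_def)
  qed (use tendsto_minus[OF Z_tendsto_0] in auto)
  then show False using Z_pos[of 1] by simp
qed

text \<open>V = H - G(Z) is nondecreasing with limit 0 at the origin and not identically 0, so it is
  positive at some \<open>r0\<close>. From there on H >= V >= V(r0).\<close>

lemma H_eventually_bounded_below:
  obtains h r0 where "0 < h" "0 < r0" "\<And>r. r0 \<le> r \<Longrightarrow> h \<le> H r"
proof -
  obtain G where G: "\<And>z. 0 < z \<Longrightarrow> (G has_real_derivative g z) (at z)"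
    and G0: "(G \<longlongrightarrow> 0) (at_right 0)" and G_nonneg: "\<And>z. 0 < z \<Longrightarrow> 0 \<le> G z"
    by (rule g_antiderivative) (rule that)
  define V where "V = (\<lambda>r. H r - G (Z r))"
  define V' where "V' = (\<lambda>r. eta * a * Z r powr b
      * (Q r * (max 0 (X r + Q r) powr a - X r powr a)) / r)"
  have dV: "(V has_real_derivative V' r) (at r)" if "0 < r" for r
    unfolding V_def V'_def by (rule lyapunov_deriv[OF that G])
  have V'_nonneg: "0 \<le> V' r" if "0 < r" for r
    unfolding V'_def using Q_times_nonneg(1)[OF that] params_pos that by simp
  \<comment> \<open>Z reaches 0 through positive values, so the right limit of G applies.\<close>
  have "filterlim Z (at_right 0) (at_right 0)"
    using Z_tendsto_0 Z_pos
    by (force simp: filterlim_at intro!: eventually_mono[OF eventually_at_right_less])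
  then have "((\<lambda>r. H r - G (Z r)) \<longlongrightarrow> 0 - 0) (at_right 0)"
    by (intro tendsto_diff H_tendsto_0 filterlim_compose[OF G0])
  then have V0: "(V \<longlongrightarrow> 0) (at_right 0)" by (simp add: V_def)
  have V_nonneg: "0 \<le> V r" if "0 < r" for r
    using right_limit_le[OF dV V'_nonneg V0 that] .
  have "\<exists>r>0. V r \<noteq> 0"
  proof (rule ccontr)
    assume "\<not> (\<exists>r>0. V r \<noteq> 0)"
    then have V_eq: "V r = 0" if "0 < r" for r using that by blast
    obtain r where r: "0 < r" "Q r \<noteq> 0" using Q_not_identically_0 by blast
    have "(V has_real_derivative 0) (at r)"
      by (rule has_field_derivative_transform_within_open[of "\<lambda>_. 0" _ _ "{0<..}"])
         (use r V_eq in auto)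
    \<comment> \<open>A vanishing V would have zero derivative at a point where Q is nonzero, but
      there V' is strictly positive.\<close>
    then have "V' r = 0" using dV[OF r(1)] DERIV_unique by blast
    moreover have "0 < V' r"
      unfolding V'_def mult.assoc[symmetric, of _ "Q r"]
      by (intro divide_pos_pos mult_pos_pos[OF _ Q_times_nonneg(2)[OF r], unfolded mult.assoc[symmetric]])
         (use params_pos Z_pos[OF r(1)] r(1) in auto)
    ultimately show False by simp
  qed
  then obtain r0 where r0: "0 < r0" "0 < V r0" using V_nonneg by force
  show ?thesis
  proof (rule that[OF r0(2,1)])
    fix r assume r: "r0 \<le> r"
    have "V r0 \<le> V r"
    proof (rule DERIV_nonneg_imp_nondecreasing[where f = V])
      show "\<exists>y. (V has_real_derivative y) (at x) \<and> 0 \<le> y" if "r0 \<le> x" "x \<le> r" for x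
        using dV[of x] V'_nonneg[of x] that r0 by auto
    qed (use r in auto)
    then show "V r0 \<le> H r"
      using G_nonneg[of "Z r"] Z_pos[of r] r r0 by (simp add: V_def)
  qed
qed

section \<open>The decay rate\<close>

text \<open>Positivity of H forces kZ < lam, which with X <= n gives the upper bound. For the lower
  one, h <= H <= (X Z^k)^a Z^k lam, where Z^k is at most (lam/k)^k.\<close>

lemma X_Z_power_bounds:
  obtains A B r0 where "0 < A" "0 < r0" "\<And>r. r0 \<le> r \<Longrightarrow> A \<le> X r * Z r ^ k"
    "\<And>r. r0 \<le> r \<Longrightarrow> X r * Z r ^ k \<le> B"
proof -
  obtain h r0 where h: "0 < h" "0 < r0" "\<And>r. r0 \<le> r \<Longrightarrow> h \<le> H r"
    by (rule H_eventually_bounded_below) (rule that)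
  let ?C = "lam * (lam / k) ^ k"
  have C: "0 < ?C" using params_pos k_pos by (intro mult_pos_pos zero_less_power divide_pos_pos) auto
  show ?thesis
  proof
    show "0 < (h / ?C) powr (1 / a)" using divide_pos_pos[OF h(1) C] by (metis powr_gt_zero less_irrefl)
    fix r assume "r0 \<le> r"
    then have r: "0 < r" "h \<le> H r" using h by auto
    have X: "0 < X r" "X r \<le> n" and Z: "0 < Z r" using r X_pos X_le Z_pos by auto
    define P where "P = X r powr a * Z r powr b"
    have P: "0 < P" using X Z by (simp add: P_def)
    have hP: "h \<le> P * (lam - k * Z r - m * X r)" using r by (simp add: H_def P_def)
    then have L: "0 < lam - k * Z r - m * X r"
      using P h(1) by (smt (verit) mult_pos_neg mult_nonneg_nonpos)
    then have kZ: "k * Z r < lam" using params_pos X by (smt (verit) mult_pos_pos)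
    then have Zle: "Z r \<le> lam / k" using k_pos by (simp add: field_simps)
    show "X r * Z r ^ k \<le> n * (lam / k) ^ k"
      using X Z Zle by (intro mult_mono power_mono) auto
    have "P = (X r * Z r ^ k) powr a * Z r ^ k"
      using X Z by (simp add: P_def b_eq powr_add powr_mult powr_realpow[symmetric] powr_powr mult_ac)
    moreover have "lam - k * Z r - m * X r \<le> lam"
      using mult_pos_pos[OF params_pos(5) X(1)] mult_nonneg_nonneg[of "real k" "Z r"] Z by linarith
    ultimately have "h \<le> (X r * Z r ^ k) powr a * Z r ^ k * lam"
      using hP P by (smt (verit) mult_left_mono)
    also have "\<dots> \<le> (X r * Z r ^ k) powr a * (lam / k) ^ k * lam"
      using X Z Zle params_pos by (intro mult_mono power_mono) auto
    finally have "h / ?C \<le> (X r * Z r ^ k) powr a"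
      using C by (simp add: pos_divide_le_eq mult_ac)
    then have "(h / ?C) powr (1 / a) \<le> ((X r * Z r ^ k) powr a) powr (1 / a)"
      using h C params_pos by (intro powr_mono2) auto
    then show "(h / ?C) powr (1 / a) \<le> X r * Z r ^ k"
      using X Z params_pos by (simp add: powr_powr)
  qed (use h in auto)
qed

lemma decay:
  "\<exists>C>1. \<forall>\<^sub>F r in at_top. 1 / C \<le> u r * r powr (2 * real k / (p - k))
                       \<and> u r * r powr (2 * real k / (p - k)) \<le> C"
proof -
  obtain A B r0 where AB: "0 < A" "0 < r0" "\<And>r. r0 \<le> r \<Longrightarrow> A \<le> X r * Z r ^ k"
    "\<And>r. r0 \<le> r \<Longrightarrow> X r * Z r ^ k \<le> B"
    by (rule X_Z_power_bounds) (rule that)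
  define \<beta> where "\<beta> = 1 / (p - k)"
  have \<beta>: "0 < \<beta>" "(p - k) * \<beta> = 1" using p_gt_k by (auto simp: \<beta>_def)
  \<comment> \<open>The summand 2 makes C > 1; the other two dominate the upper bound and the
    reciprocal of the lower bound.\<close>
  define C where "C = 2 + (c * B) powr \<beta> + 1 / (c * A) powr \<beta>"
  have cA: "0 < (c * A) powr \<beta>" using AB c_pos by simp
  then have C: "1 < C" "(c * B) powr \<beta> \<le> C" "1 / (c * A) powr \<beta> \<le> C"
    by (auto simp: C_def add_nonneg_nonneg add_pos_nonneg intro!: add_increasing)
  have "1 / C \<le> u r * r powr (2 * real k / (p - k)) \<and> u r * r powr (2 * real k / (p - k)) \<le> C"
    if r: "r0 \<le> r" for r
  proof -
    have r_pos: "0 < r" using r AB by simp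
    have u: "0 < u r" using u_pos[of r] r_pos by simp
    have eq: "u r * r powr (2 * real k / (p - k)) = (c * (X r * Z r ^ k)) powr \<beta>"
    proof -
      have "(c * (X r * Z r ^ k)) powr \<beta> = (r ^ (2 * k)) powr \<beta> * (u r powr (p - k)) powr \<beta>"
        unfolding X_Z_power[OF r_pos] by (intro powr_mult)
      also have "(u r powr (p - k)) powr \<beta> = u r"
        using u \<beta> by (simp only: powr_powr powr_one less_imp_le)
      also have "r ^ (2 * k) = r powr real (2 * k)"
        by (rule powr_realpow[OF r_pos, symmetric])
      also have "(r powr real (2 * k)) powr \<beta> = r powr (2 * real k / (p - k))"
        by (simp add: powr_powr \<beta>_def)
      finally show ?thesis by (simp only: mult.commute)
    qed
    have lo: "(c * A) powr \<beta> \<le> u r * r powr (2 * real k / (p - k))"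
      unfolding eq using AB r c_pos \<beta> by (intro powr_mono2 mult_left_mono) auto
    have hi: "u r * r powr (2 * real k / (p - k)) \<le> (c * B) powr \<beta>"
      unfolding eq using AB r r_pos c_pos \<beta> X_pos Z_pos
      by (intro powr_mono2 mult_left_mono) (auto simp: less_imp_le)
    have "1 / C \<le> (c * A) powr \<beta>"
      using C cA by (simp add: field_simps)
    then show ?thesis using lo hi C by linarith
  qed
  then have "\<forall>\<^sub>F r in at_top. 1 / C \<le> u r * r powr (2 * real k / (p - k))
                       \<and> u r * r powr (2 * real k / (p - k)) \<le> C"
    by (intro eventually_at_top_linorderI[of r0])
  with C(1) show ?thesis by (intro exI[of _ C] conjI)
qed

section \<open>Linear growth of the slope and scaling invariance\<close>

lemma v_lower_bound:
  assumes "0 < r" "0 \<le> w" "w \<le> u r"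
  shows "root k (w powr p / (c * n)) * r \<le> v r"
proof (rule power_le_imp_le_base)
  have n: "0 < n" "n = (n - k) + k" using k_less by auto
  have pos: "0 < r ^ (n - k)" using assms by simp
  have "r ^ (n - k) * (root k (w powr p / (c * n)) * r) ^ k = w powr p / (c * n) * r ^ ((n - k) + k)"
    using k_pos c_pos n(1)
    by (simp only: power_mult_distrib power_add real_root_pow_pos2 mult_ac)
       (simp add: real_root_pow_pos2 mult_ac)
  also have "\<dots> \<le> r ^ (n - k) * v r ^ k"
    using flux_lower_bound[OF assms] n(2) by (simp add: flux_def)
  \<comment> \<open>\<open>power_le_imp_le_base\<close> compares powers with a successor exponent,
    hence \<open>Suc (k - 1)\<close> for k.\<close>
  finally show "(root k (w powr p / (c * n)) * r) ^ Suc (k - 1) \<le> v r ^ Suc (k - 1)"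
    using pos k_pos by simp
qed (use v_pos[OF assms(1)] in simp)

text \<open>The exponent \<alpha> solves (\<alpha> + 2) k = \<alpha> p, which is what balances the
  powers of \<mu> on the two sides of the equation.\<close>

lemma scaled:
  fixes \<mu> :: real
  assumes mu: "0 < \<mu>"
  defines "\<alpha> \<equiv> 2 * real k / (p - k)"
  shows "radial_solution n k p c (\<lambda>r. \<mu> powr \<alpha> * u (\<mu> * r)) (\<lambda>r. \<mu> powr (\<alpha> + 1) * v (\<mu> * r))"
proof
  fix r :: real
  show "0 < \<mu> powr \<alpha> * u (\<mu> * r)" if "0 \<le> r"
    using that mu u_pos by simp
  show "continuous_on {0..} (\<lambda>r. \<mu> powr \<alpha> * u (\<mu> * r))"
    using mu by (intro continuous_on_mult continuous_on_const continuous_on_compose2[OF u_cont])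
      (auto intro!: continuous_intros)
  show "0 < \<mu> powr (\<alpha> + 1) * v (\<mu> * r)" if "0 < r"
    using that mu v_pos by simp
  show "((\<lambda>r. \<mu> powr \<alpha> * u (\<mu> * r)) has_real_derivative - (\<mu> powr (\<alpha> + 1) * v (\<mu> * r))) (at r)"
    if "0 < r"
  proof (rule DERIV_cong)
    show "((\<lambda>r. \<mu> powr \<alpha> * u (\<mu> * r)) has_real_derivative \<mu> powr \<alpha> * (- v (\<mu> * r) * (\<mu> * 1))) (at r)"
      using that mu by (intro DERIV_cmult DERIV_chain2[OF u_deriv] DERIV_ident) auto
  qed (use mu in \<open>simp add: powr_add\<close>)
  show "\<exists>B. \<forall>\<^sub>F r in at_right 0. \<mu> powr (\<alpha> + 1) * v (\<mu> * r) \<le> B"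
  proof -
    obtain B d where B: "0 < d" "\<And>y. 0 < y \<Longrightarrow> y < d \<Longrightarrow> v y \<le> B"
      using v_bounded by (auto simp: eventually_at_right_field)
    have "\<mu> powr (\<alpha> + 1) * v (\<mu> * r) \<le> \<mu> powr (\<alpha> + 1) * B" if "0 < r" "r < d / \<mu>" for r
      using that B mu by (intro mult_left_mono) (auto simp: field_simps)
    moreover have "0 < d / \<mu>" using B mu by simp
    ultimately show ?thesis unfolding eventually_at_right_field by blast
  qed
  show "((\<lambda>s. s ^ (n - k) * (\<mu> powr (\<alpha> + 1) * v (\<mu> * s)) ^ k) has_real_derivative
      r ^ (n - 1) * (\<mu> powr \<alpha> * u (\<mu> * r)) powr p / c) (at r)" if r: "0 < r"
  proof (rule DERIV_cong)
    define M where "M = \<mu> powr (\<alpha> + 1)"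
    have M: "(M * \<mu>) ^ k = (\<mu> powr \<alpha>) powr p"
    proof -
      have "M * \<mu> = \<mu> powr (\<alpha> + 2)"
        using mu by (simp add: M_def powr_add powr_numeral power2_eq_square)
      then have "(M * \<mu>) ^ k = \<mu> powr ((\<alpha> + 2) * real k)"
        using powr_realpow[of "\<mu> powr (\<alpha> + 2)" k] mu by (simp add: powr_powr)
      also have "(\<alpha> + 2) * real k = \<alpha> * p"
        using p_gt_k by (simp add: \<alpha>_def field_simps)
      finally show ?thesis by (simp add: powr_powr)
    qed
    have "(\<lambda>s. s ^ (n - k) * (M * v (\<mu> * s)) ^ k) = (\<lambda>s. M ^ k / \<mu> ^ (n - k) * flux (\<mu> * s))"
      using mu by (simp add: flux_def power_mult_distrib fun_eq_iff)
    moreover have "((\<lambda>s. M ^ k / \<mu> ^ (n - k) * flux (\<mu> * s)) has_real_derivative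
        M ^ k / \<mu> ^ (n - k) * ((\<mu> * r) ^ (n - 1) * u (\<mu> * r) powr p / c * (\<mu> * 1))) (at r)"
      using r mu by (intro DERIV_cmult DERIV_chain2[OF flux_deriv] DERIV_ident) auto
    ultimately show "((\<lambda>s. s ^ (n - k) * (\<mu> powr (\<alpha> + 1) * v (\<mu> * s)) ^ k) has_real_derivative
        M ^ k / \<mu> ^ (n - k) * ((\<mu> * r) ^ (n - 1) * u (\<mu> * r) powr p / c * (\<mu> * 1))) (at r)"
      by (simp add: M_def)
    have "n - 1 + 1 = (n - k) + k" using k_less k_pos by simp
    then have mun: "\<mu> ^ (n - 1) * \<mu> = \<mu> ^ (n - k) * \<mu> ^ k"
      by (metis power_add power_one_right)
    have "M ^ k / \<mu> ^ (n - k) * ((\<mu> * r) ^ (n - 1) * u (\<mu> * r) powr p / c * (\<mu> * 1))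
        = M ^ k / \<mu> ^ (n - k) * (\<mu> ^ (n - 1) * \<mu>) * (r ^ (n - 1) * u (\<mu> * r) powr p / c)"
      by (simp add: power_mult_distrib)
    also have "\<dots> = (M * \<mu>) ^ k * (r ^ (n - 1) * u (\<mu> * r) powr p / c)"
      unfolding mun using mu by (simp add: power_mult_distrib)
    also have "\<dots> = r ^ (n - 1) * (\<mu> powr \<alpha> * u (\<mu> * r)) powr p / c"
      unfolding M using mu r u_pos[of "\<mu> * r"] by (simp add: powr_mult)
    finally show "M ^ k / \<mu> ^ (n - k) * ((\<mu> * r) ^ (n - 1) * u (\<mu> * r) powr p / c * (\<mu> * 1))
        = r ^ (n - 1) * (\<mu> powr \<alpha> * u (\<mu> * r)) powr p / c" .
  qed
qed (use k_pos k_less supercritical c_pos in auto)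

end

section \<open>Uniqueness for the singular initial value problem\<close>

text \<open>For x <= y, replacing x^k by y^(k-1) x gives y^k - x^k >= y^(k-1) (y - x). It recovers a
  bound on the difference of slopes from one on the difference of fluxes.\<close>

lemma power_diff_lower_bound:
  fixes x y d :: real
  assumes "0 \<le> d" "d \<le> x" "d \<le> y" "0 < k"
  shows "d ^ (k - 1) * \<bar>x - y\<bar> \<le> \<bar>x ^ k - y ^ k\<bar>"
  using assms(2,3)
proof (induction x y rule: linorder_wlog)
  case (le x y)
  obtain j where j: "k = Suc j" using \<open>0 < k\<close> gr0_conv_Suc by blast
  have "d ^ j * (y - x) \<le> y ^ j * (y - x)"
    using le assms(1) by (intro mult_right_mono power_mono) auto
  also have "\<dots> = y ^ k - y ^ j * x" by (simp add: j algebra_simps)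
  also have "\<dots> \<le> y ^ k - x ^ j * x"
    using le assms(1) by (intro diff_left_mono mult_right_mono power_mono) auto
  finally show ?case using le by (simp add: j mult.commute)
next
  case (sym x y)
  then show ?case by (simp add: abs_minus_commute)
qed

lemma powr_lipschitz:
  fixes x y M p :: real
  assumes "0 < x" "0 < y" "x \<le> M" "y \<le> M" "1 < p"
  shows "\<bar>x powr p - y powr p\<bar> \<le> p * M powr (p - 1) * \<bar>x - y\<bar>"
  using assms(1-4)
proof (induction x y rule: linorder_wlog)
  case (le x y)
  show ?case
  proof (cases "x = y")
    case False
    then have "x < y" using le by simp
    moreover have "((\<lambda>z. z powr p) has_real_derivative p * z powr (p - 1)) (at z)" if "x \<le> z" for z
      using that le by (intro has_real_derivative_powr) auto
    ultimately obtain z where z: "x < z" "z < y"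
      "y powr p - x powr p = (y - x) * (p * z powr (p - 1))"
      using MVT2[of x y "\<lambda>z. z powr p" "\<lambda>z. p * z powr (p - 1)"] by blast
    have "p * z powr (p - 1) \<le> p * M powr (p - 1)"
      using z le assms(5) by (intro mult_left_mono powr_mono2) auto
    then have "(y - x) * (p * z powr (p - 1)) \<le> (y - x) * (p * M powr (p - 1))"
      by (rule mult_left_mono) (use le in simp)
    moreover have "x powr p \<le> y powr p"
      using le assms(5) by (intro powr_mono2) auto
    ultimately show ?thesis using z(3) le by (simp add: mult.commute)
  qed simp
next
  case (sym x y)
  then show ?case by (simp add: abs_minus_commute)
qed

text \<open>Since $-u' \ge \kappa r$ on $[0,R]$, the degeneracy of $t \mapsto t^k$ at $0$ is compensated by the
  factor $r^{n-1}$ in the equation; in the norm $\sup e^{-lr}|u_1 - u_2|$ each of the two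
  integrations gains a factor $1/l$.\<close>

lemma radial_solution_unique:
  assumes "radial_solution n k p c u1 v1" and "radial_solution n k p c u2 v2"
    and init: "u1 0 = u2 0" and "0 \<le> R"
  shows "u1 R = u2 R"
proof (cases "R = 0")
  case False
  then have R: "0 < R" using \<open>0 \<le> R\<close> by simp
  interpret A: radial_solution n k p c u1 v1 by fact
  interpret B: radial_solution n k p c u2 v2 by fact
  have n: "0 < n" "n - 1 = (n - k) + (k - 1)" "0 < n - 1" using A.k_less A.k_pos by auto
  \<comment> \<open>By monotonicity \<open>w\<close> bounds both solutions from below on [0,R], so
    \<open>\<kappa>\<close> is a slope constant valid for both: \<open>\<kappa> * r\<close> lies
    below \<open>v1 r\<close> and \<open>v2 r\<close>.\<close>
  define w where "w = min (u1 R) (u2 R)"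
  have w: "0 < w" using A.u_pos[of R] B.u_pos[of R] R by (simp add: w_def)
  define \<kappa> where "\<kappa> = root k (w powr p / (c * n))"
  have \<kappa>: "0 < \<kappa>" using w A.c_pos n(1) A.k_pos by (simp add: \<kappa>_def)
  \<comment> \<open>A Lipschitz constant of the p-th power on (0, u1(0)], where both solutions take
    their values.\<close>
  define L where "L = p * u1 0 powr (p - 1)"
  have L: "0 < L" using A.p_gt_1 A.u_pos[of 0] by (simp add: L_def)
  define K where "K = L / (c * \<kappa> ^ (k - 1))"
  have K: "0 < K" using L A.c_pos \<kappa> by (simp add: K_def)
  \<comment> \<open>Any positive weight with l^2 > K would do for the final contradiction.\<close>
  define l where "l = K + 1"
  have l: "0 < l" using K by (simp add: l_def)
  have "continuous_on {0..R} (\<lambda>r. exp (- l * r) * \<bar>u1 r - u2 r\<bar>)"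
    by (intro continuous_on_mult continuous_on_exp continuous_on_rabs continuous_on_diff
          continuous_on_const continuous_on_id continuous_on_subset[OF A.u_cont]
          continuous_on_subset[OF B.u_cont]) auto
  then obtain r0 where r0: "r0 \<in> {0..R}"
    and r0_max: "\<And>r. r \<in> {0..R} \<Longrightarrow> exp (- l * r) * \<bar>u1 r - u2 r\<bar> \<le> exp (- l * r0) * \<bar>u1 r0 - u2 r0\<bar>"
    using continuous_attains_sup[of "{0..R}" "\<lambda>r. exp (- l * r) * \<bar>u1 r - u2 r\<bar>"] R by auto
  \<comment> \<open>The weighted supremum norm of the difference, attained at
    \<open>r0\<close>.\<close>
  define N where "N = exp (- l * r0) * \<bar>u1 r0 - u2 r0\<bar>"
  have N0: "0 \<le> N" by (simp add: N_def)
  have N: "\<bar>u1 r - u2 r\<bar> \<le> N * exp (l * r)" if "0 \<le> r" "r \<le> R" for r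
  proof -
    have "exp (- l * r) * \<bar>u1 r - u2 r\<bar> \<le> N"
      unfolding N_def by (rule r0_max) (use that in simp)
    then have "exp (l * r) * (exp (- l * r) * \<bar>u1 r - u2 r\<bar>) \<le> exp (l * r) * N"
      by (rule mult_left_mono) simp
    then show ?thesis
      by (simp add: mult.assoc[symmetric] exp_minus mult.commute[of N])
  qed
  \<comment> \<open>The derivative of r^(n-1) e^(lr) is at least l r^(n-1) e^(lr), the remaining
    term being nonnegative. Keeping r^(n-1) in the majorant is what allows it to be cancelled in
    \<open>v_diff\<close>.\<close>
  have flux_diff: "\<bar>A.flux r - B.flux r\<bar> \<le> L * N / (c * l) * (r ^ (n - 1) * exp (l * r))"
    if "0 < r" "r \<le> R" for r
  proof (rule abs_le_of_deriv_bound[where l = 0 and f = "\<lambda>r. A.flux r - B.flux r"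
        and g = "\<lambda>r. L * N / (c * l) * (r ^ (n - 1) * exp (l * r))"])
    fix s assume s: "0 < s" "s \<le> r"
    show "((\<lambda>r. A.flux r - B.flux r) has_real_derivative
        (s ^ (n - 1) * u1 s powr p / c - s ^ (n - 1) * u2 s powr p / c)) (at s)"
      using s by (intro DERIV_diff A.flux_deriv B.flux_deriv)
    show "((\<lambda>r. L * N / (c * l) * (r ^ (n - 1) * exp (l * r))) has_real_derivative
        L * N / (c * l) * (real (n - 1) * s ^ (n - 1 - 1) * exp (l * s) + exp (l * s) * l * s ^ (n - 1))) (at s)"
      by (intro DERIV_cmult DERIV_mult) (auto intro!: derivative_eq_intros)
    have "\<bar>u1 s powr p - u2 s powr p\<bar> \<le> L * \<bar>u1 s - u2 s\<bar>"
      unfolding L_def using s A.u_pos[of s] B.u_pos[of s] A.u_antimono[of 0 s] B.u_antimono[of 0 s]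
        init A.p_gt_1 by (intro powr_lipschitz) auto
    also have "\<dots> \<le> L * (N * exp (l * s))"
      using s that L by (intro mult_left_mono N) auto
    finally have *: "\<bar>u1 s powr p - u2 s powr p\<bar> \<le> L * (N * exp (l * s))" .
    have "\<bar>s ^ (n - 1) * u1 s powr p / c - s ^ (n - 1) * u2 s powr p / c\<bar>
        = s ^ (n - 1) / c * \<bar>u1 s powr p - u2 s powr p\<bar>"
      using s A.c_pos by (simp add: abs_mult right_diff_distrib[symmetric] diff_divide_distrib[symmetric])
    also have "\<dots> \<le> s ^ (n - 1) / c * (L * (N * exp (l * s)))"
      using s A.c_pos by (intro mult_left_mono *) auto
    also have "\<dots> = L * N / (c * l) * (exp (l * s) * l * s ^ (n - 1))"
      using l A.c_pos by simp
    also have "\<dots> \<le> L * N / (c * l) *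
        (real (n - 1) * s ^ (n - 1 - 1) * exp (l * s) + exp (l * s) * l * s ^ (n - 1))"
      using s l A.c_pos L N0 by (intro mult_left_mono) auto
    finally show "\<bar>s ^ (n - 1) * u1 s powr p / c - s ^ (n - 1) * u2 s powr p / c\<bar>
      \<le> L * N / (c * l) * (real (n - 1) * s ^ (n - 1 - 1) * exp (l * s) + exp (l * s) * l * s ^ (n - 1))" .
  next
    show "((\<lambda>r. A.flux r - B.flux r) \<longlongrightarrow> 0) (at_right 0)"
      using tendsto_diff[OF A.flux_tendsto_0 B.flux_tendsto_0] by simp
    have "((\<lambda>r. L * N / (c * l) * (r ^ (n - 1) * exp (l * r))) \<longlongrightarrow>
        L * N / (c * l) * (0 ^ (n - 1) * exp (l * 0))) (at_right 0)"
      by (intro tendsto_intros)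
    then show "((\<lambda>r. L * N / (c * l) * (r ^ (n - 1) * exp (l * r))) \<longlongrightarrow> 0) (at_right 0)"
      using n(3) by (simp only: zero_power mult_zero_left mult_zero_right)
  qed (use that in auto)
  have v_diff: "\<bar>v1 r - v2 r\<bar> \<le> K * N / l * exp (l * r)" if r: "0 < r" "r \<le> R" for r
  proof -
    have le: "\<kappa> * r \<le> v1 r" "\<kappa> * r \<le> v2 r"
      unfolding \<kappa>_def using r w A.u_antimono[of r R] B.u_antimono[of r R]
      by (auto intro!: A.v_lower_bound B.v_lower_bound simp: w_def)
    \<comment> \<open>Splitting r^(n-1) = r^(n-k) r^(k-1) supplies the weight of the flux and the
      power of the common lower bound \<open>\<kappa> * r\<close>.\<close>
    have "r ^ (n - 1) * (\<kappa> ^ (k - 1) * \<bar>v1 r - v2 r\<bar>) = r ^ (n - k) * ((\<kappa> * r) ^ (k - 1) * \<bar>v1 r - v2 r\<bar>)"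
      unfolding n(2) power_add power_mult_distrib by simp
    also have "\<dots> \<le> r ^ (n - k) * \<bar>v1 r ^ k - v2 r ^ k\<bar>"
      using r \<kappa> le A.k_pos by (intro mult_left_mono power_diff_lower_bound) auto
    also have "\<dots> = \<bar>A.flux r - B.flux r\<bar>"
      using r by (simp add: A.flux_def B.flux_def abs_mult right_diff_distrib[symmetric])
    also have "\<dots> \<le> r ^ (n - 1) * (L * N / (c * l) * exp (l * r))"
      using flux_diff[OF r] by (simp only: mult_ac)
    finally have "\<kappa> ^ (k - 1) * \<bar>v1 r - v2 r\<bar> \<le> L * N / (c * l) * exp (l * r)"
      by (rule mult_left_le_imp_le) (use r in simp)
    then have "\<bar>v1 r - v2 r\<bar> \<le> L * N / (c * l) * exp (l * r) / \<kappa> ^ (k - 1)"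
      by (subst pos_le_divide_eq) (use \<kappa> in \<open>simp_all add: mult.commute\<close>)
    also have "\<dots> = K * N / l * exp (l * r)"
      by (simp add: K_def)
    finally show ?thesis .
  qed
  have "N = 0"
  proof (rule ccontr)
    assume "N \<noteq> 0"
    then have Npos: "0 < N" using N0 by simp
    have "0 < r0"
    proof (rule ccontr)
      assume "\<not> 0 < r0"
      then have "r0 = 0" using r0 by simp
      then show False using Npos init by (simp add: N_def)
    qed
    \<comment> \<open>The second integration. At \<open>r0\<close> the left side is exactly N e^(l
      r0), so N <= K N / l^2, impossible for N > 0.\<close>
    have "\<bar>u1 r0 - u2 r0\<bar> \<le> K * N / l\<^sup>2 * exp (l * r0)"
    proof (rule abs_le_of_deriv_bound[where f = "\<lambda>r. u1 r - u2 r" and g = "\<lambda>r. K * N / l\<^sup>2 * exp (l * r)"])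
      fix s assume s: "0 < s" "s \<le> r0"
      show "((\<lambda>r. u1 r - u2 r) has_real_derivative - v1 s - - v2 s) (at s)"
        using s by (intro DERIV_diff A.u_deriv B.u_deriv)
      show "((\<lambda>r. K * N / l\<^sup>2 * exp (l * r)) has_real_derivative K * N / l * exp (l * s)) (at s)"
        using l by (auto intro!: derivative_eq_intros simp: power2_eq_square)
      show "\<bar>- v1 s - - v2 s\<bar> \<le> K * N / l * exp (l * s)"
        using v_diff[of s] s r0 by auto
    next
      show "((\<lambda>r. u1 r - u2 r) \<longlongrightarrow> 0) (at_right 0)"
        using tendsto_diff[OF A.u_tendsto B.u_tendsto] init by simp
      show "((\<lambda>r. K * N / l\<^sup>2 * exp (l * r)) \<longlongrightarrow> K * N / l\<^sup>2 * exp (l * 0)) (at_right 0)"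
        by (intro tendsto_intros)
    qed (use K N0 \<open>0 < r0\<close> in auto)
    moreover have "\<bar>u1 r0 - u2 r0\<bar> = N * exp (l * r0)"
      by (simp add: N_def exp_minus)
    ultimately have "N * exp (l * r0) \<le> K * N / l\<^sup>2 * exp (l * r0)"
      by simp
    then have "N \<le> K * N / l\<^sup>2"
      by (rule mult_right_le_imp_le) simp
    then have "l\<^sup>2 * N \<le> K * N" using l by (simp add: field_simps)
    then have "l\<^sup>2 \<le> K" using Npos by simp
    moreover have "K < l\<^sup>2" using K by (simp add: l_def power2_eq_square algebra_simps add_pos_pos)
    ultimately show False by simp
  qed
  then show ?thesis using N[of R] R by simp
qed (simp add: init)

section \<open>From regular solutions to the flux form\<close>

text \<open>Along a ray with unit direction e, u'(r) is the differential of the radial function at r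
  e applied to e, and this differential is continuous at the origin.\<close>

lemma C2_radial_deriv_bounded:
  fixes u :: "real \<Rightarrow> real"
  assumes "C2_UNIV (\<lambda>x :: real ^ 'n::finite. u (norm x))"
    and diff: "\<And>r. 0 < r \<Longrightarrow> u differentiable (at r)"
  obtains B where "\<forall>\<^sub>F r in at_right 0. \<bar>deriv u r\<bar> \<le> B"
proof -
  obtain D :: "real ^ 'n \<Rightarrow> ((real ^ 'n) \<Rightarrow>\<^sub>L real)" and D2
    where D: "\<And>x. ((\<lambda>x. u (norm x)) has_derivative blinfun_apply (D x)) (at x)"
      and D2: "\<And>x. (D has_derivative blinfun_apply (D2 x)) (at x)"
    using assms(1) unfolding C2_UNIV_def by blast
  obtain e :: "real ^ 'n" where e: "norm e = 1" using vector_choose_size[of 1] by auto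
  have deriv_eq: "deriv u r = blinfun_apply (D (r *\<^sub>R e)) e" if "0 < r" for r
  proof -
    have "((\<lambda>s. u (norm (s *\<^sub>R e))) has_derivative (\<lambda>h. blinfun_apply (D (r *\<^sub>R e)) (h *\<^sub>R e))) (at r)"
      by (rule has_derivative_compose[OF _ D]) (auto intro!: derivative_eq_intros)
    then have "((\<lambda>s. u (norm (s *\<^sub>R e))) has_real_derivative blinfun_apply (D (r *\<^sub>R e)) e) (at r)"
      unfolding has_field_derivative_def by (simp add: blinfun.scaleR_right mult.commute[of _ "blinfun_apply _ _"])
    \<comment> \<open>The norm of s e is s only for positive s, so the two functions are identified
      on the open half-line.\<close>
    then have "(u has_real_derivative blinfun_apply (D (r *\<^sub>R e)) e) (at r)"
      by (rule has_field_derivative_transform_within_open[of _ _ _ "{0<..}"]) (use that e in auto)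
    then show ?thesis by (rule DERIV_imp_deriv)
  qed
  have "isCont D 0" using has_derivative_continuous[OF D2] .
  moreover have "((\<lambda>r. r *\<^sub>R e) \<longlongrightarrow> 0) (at_right 0)"
    by (auto intro!: tendsto_eq_intros)
  ultimately have "((\<lambda>r. D (r *\<^sub>R e)) \<longlongrightarrow> D 0) (at_right 0)"
    by (rule isCont_tendsto_compose)
  then have "\<forall>\<^sub>F r in at_right 0. norm (D (r *\<^sub>R e)) < norm (D 0) + 1"
    by (intro order_tendstoD(2)[OF tendsto_norm]) auto
  moreover have "\<forall>\<^sub>F r::real in at_right 0. 0 < r" by (rule eventually_at_right_less)
  ultimately have "\<forall>\<^sub>F r in at_right 0. \<bar>deriv u r\<bar> \<le> norm (D 0) + 1"
  proof eventually_elim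
    case (elim r)
    then show ?case using norm_blinfun[of "D (r *\<^sub>R e)" e] e by (simp add: deriv_eq)
  qed
  then show ?thesis by (rule that)
qed

text \<open>The point is the sign of u': the signed flux W has limit 0 at the origin and negative
  derivative, so W < 0 and therefore u' < 0. The absolute value in the equation can then be
  resolved.\<close>

lemma regular_sol_imp_radial_solution:
  fixes n k :: nat
  assumes "CARD('n::finite) = n" and k: "0 < k" "2 * k < n"
    and p: "p > real ((n + 2) * k) / (real n - 2 * real k)"
    and "0 < \<rho>" and sol: "regular_sol TYPE('n) k p \<rho> u"
  shows "radial_solution n k p (real ((n - 1) choose (k - 1)) / k) u (\<lambda>r. - deriv u r)"
proof -
  define c where "c = real ((n - 1) choose (k - 1)) / k"
  have c: "0 < c" using k by (simp add: c_def)
  have u0: "u 0 = \<rho>" and u_pos: "\<And>r. 0 < r \<Longrightarrow> 0 < u r"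
    and du0: "(u has_real_derivative 0) (at 0 within {0..})"
    and diff: "\<And>r. 0 < r \<Longrightarrow> u differentiable (at r)"
    and C2: "C2_UNIV (\<lambda>x :: real ^ 'n. u (norm x))"
    using sol by (auto simp: regular_sol_def sol16_def)
  define W where "W = (\<lambda>s. s ^ (n - k) * \<bar>deriv u s\<bar> ^ (k - 1) * deriv u s)"
  have dW: "(W has_real_derivative - (r ^ (n - 1) * u r powr p / c)) (at r)" if r: "0 < r" for r
  proof -
    obtain W' where W': "(W has_real_derivative W') (at r)"
      "- (1 / real k) * real ((n - 1) choose (k - 1)) * W' = r ^ (n - 1) * u r powr p"
      using sol r assms(1) unfolding regular_sol_def sol16_def W_def by blast
    have "- (c * W') = r ^ (n - 1) * u r powr p" using W'(2) by (simp add: c_def)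
    then have "W' = - (r ^ (n - 1) * u r powr p / c)" using c by (simp add: field_simps)
    then show ?thesis using W'(1) by simp
  qed
  obtain B where B: "\<forall>\<^sub>F r in at_right 0. \<bar>deriv u r\<bar> \<le> B"
    using C2_radial_deriv_bounded[OF C2 diff] by blast
  have W_lim: "((\<lambda>r. - W r) \<longlongrightarrow> 0) (at_right 0)"
  proof (rule Lim_null_comparison)
    show "\<forall>\<^sub>F r in at_right 0. norm (- W r) \<le> r ^ (n - k) * B ^ k"
      using B eventually_at_right_less[of "0::real"]
    proof eventually_elim
      case (elim r)
      have "norm (- W r) = r ^ (n - k) * \<bar>deriv u r\<bar> ^ Suc (k - 1)"
        using elim by (simp add: W_def abs_mult power_abs)
      also have "\<dots> \<le> r ^ (n - k) * B ^ Suc (k - 1)"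
        using elim by (intro mult_left_mono power_mono) auto
      finally show ?case using k by simp
    qed
    have "((\<lambda>r::real. r ^ (n - k) * B ^ k) \<longlongrightarrow> 0 ^ (n - k) * B ^ k) (at_right 0)"
      by (intro tendsto_intros)
    then show "((\<lambda>r::real. r ^ (n - k) * B ^ k) \<longlongrightarrow> 0) (at_right 0)"
      using k by (simp add: zero_power)
  qed
  have W'_pos: "0 < r ^ (n - 1) * u r powr p / c" if "0 < r" for r
    using that c u_pos[OF that] by simp
  have dmW: "((\<lambda>r. - W r) has_real_derivative r ^ (n - 1) * u r powr p / c) (at r)" if "0 < r" for r
    using DERIV_minus[OF dW[OF that]] by simp
  have W_neg: "W r < 0" if r: "0 < r" for r
  proof -
    \<comment> \<open>The limit comparison is not strict; strictness is gained on the interval from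
      r/2 to r.\<close>
    have "0 \<le> - W (r / 2)"
      by (rule right_limit_le[OF dmW _ W_lim]) (use r W'_pos in \<open>auto intro: less_imp_le\<close>)
    moreover have "- W (r / 2) < - W r"
    proof (rule DERIV_pos_imp_increasing[where f = "\<lambda>r. - W r"])
      show "\<exists>y. ((\<lambda>r. - W r) has_real_derivative y) (at x) \<and> 0 < y" if "r / 2 \<le> x" "x \<le> r" for x
        using dmW[of x] W'_pos[of x] that r by auto
    qed (use r in auto)
    ultimately show ?thesis by simp
  qed
  have deriv_neg: "deriv u r < 0" if r: "0 < r" for r
  proof (rule ccontr)
    assume "\<not> deriv u r < 0"
    then have "0 \<le> W r" using r by (simp add: W_def)
    then show False using W_neg[OF r] by simp
  qed
  have u_deriv: "(u has_real_derivative deriv u r) (at r)" if "0 < r" for r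
    using diff[OF that] DERIV_deriv_iff_real_differentiable by blast
  have "radial_solution n k p c u (\<lambda>r. - deriv u r)"
  proof
    show "0 < u r" if "0 \<le> r" for r
      using that u_pos u0 \<open>0 < \<rho>\<close> by (cases "r = 0") auto
    show "continuous_on {0..} u"
      unfolding continuous_on_eq_continuous_within
    proof
      fix x :: real assume "x \<in> {0..}"
      then consider "x = 0" | "0 < x" by force
      then show "continuous (at x within {0..}) u"
      proof cases
        case 1
        then show ?thesis using DERIV_continuous[OF du0] by simp
      next
        case 2
        then show ?thesis
          using DERIV_isCont[OF u_deriv] continuous_at_imp_continuous_at_within by blast
      qed
    qed
    show "\<exists>B. \<forall>\<^sub>F r in at_right 0. - deriv u r \<le> B"
      by (intro exI[of _ B] eventually_mono[OF B]) simp
    show "((\<lambda>s. s ^ (n - k) * (- deriv u s) ^ k) has_real_derivative r ^ (n - 1) * u r powr p / c) (at r)"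
      if "0 < r" for r
    proof (rule has_field_derivative_transform_within_open[OF dmW[OF that], of "{0<..}"])
      fix s :: real assume "s \<in> {0<..}"
      then have "deriv u s < 0" using deriv_neg by simp
      moreover have "(- deriv u s) ^ k = (- deriv u s) ^ (k - 1) * (- deriv u s)"
        by (rule power_minus_mult[OF k(1), symmetric])
      ultimately show "- W s = s ^ (n - k) * (- deriv u s) ^ k"
        by (simp add: W_def)
    qed (use that in auto)
  qed (use k p c deriv_neg u_deriv in auto)
  then show ?thesis by (simp add: c_def)
qed

section \<open>Decay and scaling form of regular solutions\<close>

theorem theorem1p2:
  fixes n k :: nat and p \<rho> :: real and u :: "real \<Rightarrow> real"
  assumes "CARD('n::finite) = n"
    and "n \<ge> 3" and "1 < k" and "real k < real n / 2"
    and "p > real ((n + 2) * k) / (real n - 2 * real k)"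
    and "\<rho> > 0" and "regular_sol TYPE('n) k p \<rho> u"
  shows "(\<exists>C>1. \<forall>\<^sub>F r in at_top. 1 / C \<le> u r * r powr (2 * real k / (p - real k))
                                  \<and> u r * r powr (2 * real k / (p - real k)) \<le> C)
       \<and> (\<forall>u1. regular_sol TYPE('n) k p 1 u1 \<longrightarrow>
             (\<exists>\<mu>>0. \<forall>r\<ge>0. u r = \<mu> powr (2 * real k / (p - real k)) * u1 (\<mu> * r)))"
proof -
  have k: "0 < k" "2 * k < n" using assms(3,4) by linarith+
  interpret radial_solution n k p "real ((n - 1) choose (k - 1)) / k" u "\<lambda>r. - deriv u r"
    by (rule regular_sol_imp_radial_solution[OF assms(1) k assms(5-7)])
  have u0: "u 0 = \<rho>" using assms(7) by (simp add: regular_sol_def sol16_def)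
  have "\<exists>\<mu>>0. \<forall>r\<ge>0. u r = \<mu> powr (2 * real k / (p - real k)) * u1 (\<mu> * r)"
    if u1: "regular_sol TYPE('n) k p 1 u1" for u1
  proof -
    interpret U1: radial_solution n k p "real ((n - 1) choose (k - 1)) / k" u1 "\<lambda>r. - deriv u1 r"
      by (rule regular_sol_imp_radial_solution[OF assms(1) k assms(5) zero_less_one u1])
    \<comment> \<open>Chosen so that the rescaled \<open>u1\<close> has initial value
      \<open>\<rho>\<close>; uniqueness then identifies it with \<open>u\<close>.\<close>
    define \<mu> where "\<mu> = \<rho> powr ((p - k) / (2 * real k))"
    have \<mu>: "0 < \<mu>" using assms(6) by (simp add: \<mu>_def)
    have "\<mu> powr (2 * real k / (p - k)) = \<rho>"
      using k p_gt_k assms(6) by (simp add: \<mu>_def powr_powr)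
    moreover have "u1 0 = 1" using u1 by (simp add: regular_sol_def sol16_def)
    ultimately have "u 0 = \<mu> powr (2 * real k / (p - k)) * u1 (\<mu> * 0)"
      using u0 by simp
    then have "\<forall>r\<ge>0. u r = \<mu> powr (2 * real k / (p - k)) * u1 (\<mu> * r)"
      using radial_solution_unique[OF radial_solution_axioms U1.scaled[OF \<mu>]] by simp
    then show ?thesis using \<mu> by blast
  qed
  then show ?thesis using decay by blast
qed

end
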